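(* Let $R$ be an $n\times n$ expanding integer matrix, let $m\ge 1$ be an integer, and let $\mathcal{D}\subset\mathbb{Z}^n$ be a set with $\#\mathcal{D}=|\det R|$. If $\mathcal{D}$ is an $m$-stage skew-product-form digit set with respect to $R$, then $\mathcal{D}_m=\mathcal{D}+R\mathcal{D}+\cdots+R^{m-1}\mathcal{D}$ is a skew-product-form digit set with respect to $R^m$.
   Context: An $n\times n$ integer matrix $R$ is expanding if all its eigenvalues have modulus strictly larger than $1$. A complete residue set modulo $R$ is a subset of $\mathbb{Z}^n$ containing exactly one element of each coset of $R\mathbb{Z}^n$ in $\mathbb{Z}^n$. $\mathcal{A}\oplus\mathcal{B}$ denotes the sumset $\mathcal{A}+\mathcal{B}$ when all sums $a+b$ ($a\in\mathcal{A}$, $b\in\mathcal{B}$) are distinct. For an expanding integer matrix $R$ and an integer $m\ge 1$, a set $\mathcal{D}\subset\mathbb{Z}^n$ with $\#\mathcal{D}=|\det R|$ is an $m$-stage skew-product-form digit set with respect to $R$ if there exist $\mathcal{A}=\{a_j\}_{j=0}^{s-1}\subset\mathbb{Z}^n$ (with $s$ distinct elements) and $\mathcal{B}_0,\dots,\mathcal{B}_{s-1}\subset\mathbb{Z}^n$ such that $\mathcal{D}=\bigcup_{j=0}^{s-1}(a_j+R^m\mathcal{B}_j)$ and, for each $j=0,\dots,s-1$, the sum $\mathcal{A}+\mathcal{B}_j$ is direct and $\mathcal{A}\oplus\mathcal{B}_j$ is a complete residue set modulo $R$. When $m=1$, $\mathcal{D}$ is called a skew-product-form digit set with respect to $R$.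 Thus a set $\mathcal{E}\subset\mathbb{Z}^n$ is a skew-product-form digit set with respect to $R^m$ if $\#\mathcal{E}=|\det R|^m$ and $\mathcal{E}=\bigcup_{j}(a_j+R^m\mathcal{B}_j)$ with $\mathcal{A}=\{a_j\}$ and each $\mathcal{A}\oplus\mathcal{B}_j$ a complete residue set modulo $R^m$. *)

theory Defs
  imports "HOL-Analysis.Analysis" "HOL-Library.Set_Algebras"
begin

primrec matpow :: "'a::semiring_1 ^ 'n ^ 'n \<Rightarrow> nat \<Rightarrow> 'a ^ 'n ^ 'n" where
  "matpow R 0 = mat 1"
| "matpow R (Suc k) = R ** matpow R k"

definition eigenvalue :: "complex ^ 'n ^ 'n \<Rightarrow> complex \<Rightarrow> bool" where
  "eigenvalue M z \<longleftrightarrow> (\<exists>v. v \<noteq> 0 \<and> M *v v = z *s v)"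

text \<open>Eigenvalues of an integer matrix are its complex eigenvalues.\<close>

definition expanding :: "int ^ 'n ^ 'n \<Rightarrow> bool" where
  "expanding R \<longleftrightarrow> (\<forall>z. eigenvalue (map_matrix of_int R) z \<longrightarrow> cmod z > 1)"

definition cosets_of_image :: "int ^ 'n ^ 'n \<Rightarrow> (int ^ 'n) set set" where
  "cosets_of_image R = {(+) x ` range ((*v) R) | x. True}"

definition complete_residue_set :: "int ^ 'n ^ 'n \<Rightarrow> (int ^ 'n) set \<Rightarrow> bool" where
  "complete_residue_set R C \<longleftrightarrow> (\<forall>K \<in> cosets_of_image R. \<exists>!c. c \<in> C \<inter> K)"

definition direct_sumset :: "'a::plus set \<Rightarrow> 'a set \<Rightarrow> bool" where
  "direct_sumset A B \<longleftrightarrow> inj_on (\<lambda>(a, b). a + b) (A \<times> B)"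

text \<open>The matrix is meant to be expanding and the number of stages positive; both are
  ambient assumptions, not part of the definition. Sums of sets are sumsets.\<close>

definition staged_skew_product_digit_set ::
    "nat \<Rightarrow> int ^ 'n ^ 'n \<Rightarrow> (int ^ 'n) set \<Rightarrow> bool" where
  "staged_skew_product_digit_set m R D \<longleftrightarrow>
     finite D \<and> int (card D) = \<bar>det R\<bar> \<and>
     (\<exists>s (a :: nat \<Rightarrow> int ^ 'n) (B :: nat \<Rightarrow> (int ^ 'n) set).
        inj_on a {..<s} \<and>
        D = (\<Union>j<s. {a j} + (*v) (matpow R m) ` B j) \<and>
        (\<forall>j<s. direct_sumset (a ` {..<s}) (B j) \<and>
               complete_residue_set R (a ` {..<s} + B j)))"

definition skew_product_digit_set :: "int ^ 'n ^ 'n \<Rightarrow> (int ^ 'n) set \<Rightarrow> bool" where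
  "skew_product_digit_set R D \<longleftrightarrow> staged_skew_product_digit_set 1 R D"

end

theory Submission
  imports Defs
begin

text \<open>
  Digit expansions explain the theorem. If \<open>C\<^sub>0, \<dots>, C\<^bsub>m-1\<^esub>\<close> are complete residue sets modulo an
  injective \<open>R\<close>, then every vector has a unique residue
  \<open>c\<^sub>0 + R c\<^sub>1 + \<dots> + R\<^bsup>m-1\<^esup> c\<^bsub>m-1\<^esub>\<close> modulo \<open>R\<^sup>m\<close>. A digit of \<open>D\<close> has the form \<open>a + R\<^sup>m b\<close> with
  \<open>b \<in> B a\<close>. Summing \<open>m\<close> of them gives a first part \<open>\<Sum>k<m. R\<^sup>k a\<^sub>k\<close>, which lies in
  \<open>A' = \<Sum>k<m. R\<^sup>k A\<close> and determines all the \<open>a\<^sub>k\<close>, plus \<open>R\<^sup>m\<close> times an element of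
  \<open>\<Sum>k<m. R\<^sup>k (B a\<^sub>k)\<close>. For each choice of the \<open>a\<^sub>k\<close>, the direct sum of \<open>A'\<close> with the latter set
  has digits from \<open>C\<^sub>k = A \<oplus> B a\<^sub>k\<close>, so it is a complete residue set modulo \<open>R\<^sup>m\<close>.

  The whole argument is one composition step, from moduli \<open>M\<^sub>1\<close> and \<open>M\<^sub>2\<close> to \<open>M\<^sub>1 ** M\<^sub>2\<close>, iterated by
  induction: \<open>factors_residues_compose\<close> is the step for a single direct sum, and
  \<open>skew_form_compose\<close> the step for the skew-product structure. For this the matrix \<open>P\<close>
  that multiplies the sets \<open>B a\<close> has to be kept apart from the modulus, because \<open>P = R\<^sup>m\<close> stays put
  while the modulus runs through \<open>R\<^sup>0, \<dots>, R\<^sup>m\<close>.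

  The same uniqueness of digits gives the cardinality: it shows that all sums in
  \<open>D + R D + \<dots> + R\<^bsup>m-1\<^esup> D\<close> are distinct (\<open>card_sumset_skew_form\<close>), so their number is
  \<open>(card D)\<^sup>m = \<bar>det R\<bar>\<^sup>m\<close>. Expansion enters only through the injectivity of \<open>R\<close>:
  the number \<open>0\<close> is not an eigenvalue.
\<close>

section \<open>Powers of an expanding matrix\<close>

text \<open>An integer vector in the kernel would be a complex eigenvector for the eigenvalue \<open>0\<close>.\<close>

lemma expanding_imp_inj:
  fixes R :: "int ^ 'n ^ 'n"
  assumes "expanding R"
  shows "inj ((*v) R)"
proof (rule injI)
  fix x y :: "int ^ 'n"
  assume eq: "R *v x = R *v y"
  define v :: "complex ^ 'n" where "v = (\<chi> i. of_int ((x - y) $ i))"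
  have "R *v (x - y) = 0"
    using eq by (simp add: matrix_vector_mult_diff_distrib)
  then have "(\<Sum>j\<in>UNIV. R $ i $ j * (x - y) $ j) = 0" for i
    by (simp add: matrix_vector_mult_def vec_eq_iff)
  then have "(\<Sum>j\<in>UNIV. complex_of_int (R $ i $ j) * of_int ((x - y) $ j)) = 0" for i
    by (metis (no_types, lifting) of_int_0 of_int_mult of_int_sum sum.cong)
  then have "map_matrix of_int R *v v = 0 *s v"
    by (simp add: matrix_vector_mult_def vec_eq_iff v_def)
  then have "v = 0"
    using assms unfolding expanding_def eigenvalue_def by (metis norm_zero not_one_less_zero)
  then show "x = y"
    by (simp add: v_def vec_eq_iff)
qed

lemma matpow_add: "matpow R (j + k) = matpow R j ** matpow R k"
  by (induction j) (simp_all add: matrix_mul_assoc)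

lemma matpow_Suc_right: "matpow R (Suc k) = matpow R k ** R"
  using matpow_add[of R k 1] by simp

lemma inj_matpow: "inj ((*v) R) \<Longrightarrow> inj ((*v) (matpow R k))"
proof (induction k)
  case (Suc k)
  then have "inj ((*v) R \<circ> (*v) (matpow R k))"
    by (intro inj_compose) auto
  then show ?case
    by (simp add: o_def matrix_vector_mul_assoc)
qed (simp add: inj_def)

lemma det_matpow: "det (matpow R k) = det (R :: 'a::comm_ring_1 ^ 'n ^ 'n) ^ k"
  by (induction k) (simp_all add: det_mul)

section \<open>Direct factorizations of complete residue sets\<close>

definition factors_residues ::
    "int ^ 'n ^ 'n \<Rightarrow> (int ^ 'n) set \<Rightarrow> (int ^ 'n) set \<Rightarrow> bool" where
  "factors_residues M A B \<longleftrightarrow>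
     (\<forall>x. \<exists>a\<in>A. \<exists>b\<in>B. \<exists>z. x = a + b + M *v z) \<and>
     (\<forall>a\<in>A. \<forall>a'\<in>A. \<forall>b\<in>B. \<forall>b'\<in>B. \<forall>z. a + b = a' + b' + M *v z \<longrightarrow> a = a' \<and> b = b')"

lemma factors_residues_cover:
  assumes "factors_residues M A B"
  obtains a b z where "a \<in> A" "b \<in> B" "x = a + b + M *v z"
  using assms unfolding factors_residues_def by blast

lemma factors_residues_unique:
  assumes "factors_residues M A B" "a \<in> A" "a' \<in> A" "b \<in> B" "b' \<in> B"
    and "a + b = a' + b' + M *v z"
  shows "a = a'" "b = b'"
  using assms unfolding factors_residues_def by blast+

text \<open>The second factor is nonempty; adding one of its elements to both sides turns a congruence
  in the first factor into one between sums.\<close>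

lemma factors_residues_unique_left:
  assumes F: "factors_residues M A B" and "a \<in> A" "a' \<in> A" "a = a' + M *v z"
  shows "a = a'"
proof -
  obtain b where "b \<in> B"
    by (rule factors_residues_cover[OF F]) blast
  then show ?thesis
    using factors_residues_unique(1)[OF F, of a a' b b z] assms by (simp add: algebra_simps)
qed

lemma factors_residues_unique_right:
  assumes F: "factors_residues M A B" and "b \<in> B" "b' \<in> B" "b = b' + M *v z"
  shows "b = b'"
proof -
  obtain a where "a \<in> A"
    by (rule factors_residues_cover[OF F]) blast
  then show ?thesis
    using factors_residues_unique(2)[OF F, of a a b b' z] assms by (simp add: algebra_simps)
qed

lemma complete_residue_set_iff:
  "complete_residue_set M C \<longleftrightarrow> (\<forall>x. \<exists>!c. c \<in> C \<and> (\<exists>z. c = x + M *v z))"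
  unfolding complete_residue_set_def cosets_of_image_def
  by (simp add: image_image image_iff Ball_def) blast

lemma factors_residues_iff:
  "factors_residues M A B \<longleftrightarrow> direct_sumset A B \<and> complete_residue_set M (A + B)"
proof
  assume F: "factors_residues M A B"
  have "direct_sumset A B"
    unfolding direct_sumset_def
    by (rule inj_onI) (use factors_residues_unique[OF F, where z = 0] in auto)
  moreover have "\<exists>!c. c \<in> A + B \<and> (\<exists>z. c = x + M *v z)" for x
  proof -
    obtain a b z where ab: "a \<in> A" "b \<in> B" "x = a + b + M *v z"
      using factors_residues_cover[OF F] .
    show ?thesis
    proof (rule ex1I[of _ "a + b"])
      have "a + b = x + M *v (- z)"
        using ab matrix_vector_mult_diff_distrib[of M 0 z] by simp
      then show "a + b \<in> A + B \<and> (\<exists>z. a + b = x + M *v z)"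
        using ab by blast
    next
      fix c assume "c \<in> A + B \<and> (\<exists>z. c = x + M *v z)"
      then obtain a' b' w where c: "a' \<in> A" "b' \<in> B" "c = a' + b'" "c = x + M *v w"
        by (auto elim: set_plus_elim)
      then have "a' + b' = a + b + M *v (z + w)"
        using ab by (simp add: algebra_simps)
      then show "c = a + b"
        using factors_residues_unique[OF F] ab c by metis
    qed
  qed
  ultimately show "direct_sumset A B \<and> complete_residue_set M (A + B)"
    by (simp add: complete_residue_set_iff)
next
  assume "direct_sumset A B \<and> complete_residue_set M (A + B)"
  then have dir: "inj_on (\<lambda>(a, b). a + b) (A \<times> B)"
    and crs: "\<And>x. \<exists>!c. c \<in> A + B \<and> (\<exists>z. c = x + M *v z)"
    by (auto simp: direct_sumset_def complete_residue_set_iff)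
  show "factors_residues M A B"
    unfolding factors_residues_def
  proof (intro conjI ballI allI impI)
    fix x
    obtain c z where c: "c \<in> A + B" "c = x + M *v z"
      using crs by blast
    then have "x = c + M *v (- z)"
      using matrix_vector_mult_diff_distrib[of M 0 z] by simp
    then show "\<exists>a\<in>A. \<exists>b\<in>B. \<exists>z. x = a + b + M *v z"
      using c(1) by (auto elim!: set_plus_elim)
  next
    fix a a' b b' z
    assume mem: "a \<in> A" "a' \<in> A" "b \<in> B" "b' \<in> B" and eq: "a + b = a' + b' + M *v z"
    have "a' + b' = a' + b' + M *v 0"
      by simp
    then have "a + b = a' + b'"
      using crs[of "a' + b'"] mem eq set_plus_intro by metis
    then show "a = a'" "b = b'"
      using inj_onD[OF dir, of "(a, b)" "(a', b')"] mem by auto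
  qed
qed

text \<open>Two-digit expansions: the first digit is the residue modulo \<open>M\<^sub>1\<close>, and after cancelling it and
  then the injective \<open>M\<^sub>1\<close>, the second digit is the residue of the quotient modulo \<open>M\<^sub>2\<close>.\<close>

lemma factors_residues_compose:
  assumes F1: "factors_residues M1 A1 B1" and F2: "factors_residues M2 A2 B2"
    and inj: "inj ((*v) M1)"
  shows "factors_residues (M1 ** M2) (A1 + (*v) M1 ` A2) (B1 + (*v) M1 ` B2)"
  unfolding factors_residues_def
proof (intro conjI ballI allI impI)
  fix x
  obtain a1 b1 z where 1: "a1 \<in> A1" "b1 \<in> B1" "x = a1 + b1 + M1 *v z"
    using factors_residues_cover[OF F1] .
  obtain a2 b2 w where 2: "a2 \<in> A2" "b2 \<in> B2" "z = a2 + b2 + M2 *v w"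
    using factors_residues_cover[OF F2] .
  have "x = (a1 + M1 *v a2) + (b1 + M1 *v b2) + (M1 ** M2) *v w"
    using 1 2 by (simp add: algebra_simps matrix_vector_mul_assoc)
  then show "\<exists>a\<in>A1 + (*v) M1 ` A2. \<exists>b\<in>B1 + (*v) M1 ` B2. \<exists>z. x = a + b + (M1 ** M2) *v z"
    using 1 2 by blast
next
  fix a a' b b' z
  assume "a \<in> A1 + (*v) M1 ` A2" "a' \<in> A1 + (*v) M1 ` A2"
    "b \<in> B1 + (*v) M1 ` B2" "b' \<in> B1 + (*v) M1 ` B2"
  then obtain a1 a2 a1' a2' b1 b2 b1' b2'
    where mem: "a1 \<in> A1" "a2 \<in> A2" "a1' \<in> A1" "a2' \<in> A2"
      "b1 \<in> B1" "b2 \<in> B2" "b1' \<in> B1" "b2' \<in> B2"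
      and ab: "a = a1 + M1 *v a2" "a' = a1' + M1 *v a2'"
        "b = b1 + M1 *v b2" "b' = b1' + M1 *v b2'"
    by (auto elim!: set_plus_elim)
  assume eq: "a + b = a' + b' + (M1 ** M2) *v z"
  then have "a1 + b1 = a1' + b1' + M1 *v (a2' + b2' + M2 *v z - (a2 + b2))"
    by (simp add: ab algebra_simps matrix_vector_mul_assoc)
  from factors_residues_unique[OF F1 _ _ _ _ this] have 1: "a1 = a1'" "b1 = b1'"
    using mem by auto
  have "M1 *v (a2 + b2) = M1 *v (a2' + b2' + M2 *v z)"
    using eq 1 by (simp add: ab algebra_simps matrix_vector_mul_assoc)
  then have "a2 + b2 = a2' + b2' + M2 *v z"
    using inj by (simp add: inj_eq)
  from factors_residues_unique[OF F2 _ _ _ _ this] have "a2 = a2'" "b2 = b2'"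
    using mem by auto
  with 1 show "a = a'" "b = b'"
    by (simp_all add: ab)
qed

section \<open>Skew-product structures\<close>

text \<open>Indexing the sets \<open>B\<close> by the elements of \<open>A\<close> instead of by an enumeration of \<open>A\<close> lets
  structures be composed without coding pairs of indices as numbers.\<close>

definition skew_form ::
    "int ^ 'n ^ 'n \<Rightarrow> int ^ 'n ^ 'n \<Rightarrow> (int ^ 'n) set \<Rightarrow> (int ^ 'n \<Rightarrow> (int ^ 'n) set) \<Rightarrow>
     (int ^ 'n) set \<Rightarrow> bool" where
  "skew_form P M A B D \<longleftrightarrow>
     finite A \<and> D = (\<Union>a\<in>A. {a} + (*v) P ` B a) \<and> (\<forall>a\<in>A. factors_residues M A (B a))"

lemma skew_formD:
  assumes "skew_form P M A B D"
  shows "finite A" "D = (\<Union>a\<in>A. {a} + (*v) P ` B a)"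
    "\<And>a. a \<in> A \<Longrightarrow> factors_residues M A (B a)"
  using assms unfolding skew_form_def by auto

lemma skew_form_mem:
  assumes "skew_form P M A B D"
  shows "x \<in> D \<longleftrightarrow> (\<exists>a\<in>A. \<exists>b\<in>B a. x = a + P *v b)"
  unfolding skew_formD(2)[OF assms] by (auto simp: set_plus_def)

lemma staged_skew_product_digit_set_iff:
  fixes R :: "int ^ 'n ^ 'n"
  shows "staged_skew_product_digit_set m R D \<longleftrightarrow>
     finite D \<and> int (card D) = \<bar>det R\<bar> \<and> (\<exists>A B. skew_form (matpow R m) R A B D)"
proof -
  have "(\<exists>s (a :: nat \<Rightarrow> _) B. inj_on a {..<s} \<and> D = (\<Union>j<s. {a j} + (*v) P ` B j) \<and>
           (\<forall>j<s. factors_residues R (a ` {..<s}) (B j))) \<longleftrightarrow>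
        (\<exists>A B. skew_form P R A B D)" (is "?indexed \<longleftrightarrow> ?unindexed")
    for P :: "int ^ 'n ^ 'n"
  proof
    assume ?indexed
    then obtain s and a :: "nat \<Rightarrow> int ^ 'n" and B
      where inj: "inj_on a {..<s}" and D: "D = (\<Union>j<s. {a j} + (*v) P ` B j)"
        and F: "\<forall>j<s. factors_residues R (a ` {..<s}) (B j)"
      by blast
    have "skew_form P R (a ` {..<s}) (\<lambda>x. B (the_inv_into {..<s} a x)) D"
      using F by (simp add: skew_form_def D the_inv_into_f_f[OF inj])
    then show ?unindexed
      by blast
  next
    assume ?unindexed
    then obtain A B where S: "skew_form P R A B D"
      by blast
    obtain a where "bij_betw a {..<card A} A"
      using ex_bij_betw_nat_finite[OF skew_formD(1)[OF S]] by (auto simp: atLeast0LessThan)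
    then have a: "inj_on a {..<card A}" "a ` {..<card A} = A"
      by (auto simp: bij_betw_def)
    have "D = (\<Union>j<card A. {a j} + (*v) P ` B (a j))"
      using skew_formD(2)[OF S] by (subst (asm) a(2)[symmetric]) simp
    moreover have "\<forall>j<card A. factors_residues R (a ` {..<card A}) (B (a j))"
      using skew_formD(3)[OF S] a(2) by auto
    ultimately show ?indexed
      using a(1) by (intro exI[of _ "card A"] exI[of _ a] exI[of _ "\<lambda>j. B (a j)"]) simp
  qed
  from this[of "matpow R m"] show ?thesis
    unfolding staged_skew_product_digit_set_def factors_residues_iff[symmetric] by simp
qed

text \<open>Distinct elements of \<open>A\<^sub>1\<close> are incongruent modulo \<open>M\<^sub>1\<close>, so a pair \<open>(a\<^sub>1, a\<^sub>2)\<close> can be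
  recovered from \<open>a\<^sub>1 + M\<^sub>1 a\<^sub>2\<close>. This is what allows the second factor of
  a composed structure to be a function of that sum.\<close>

lemma inj_on_two_digits:
  assumes S1: "skew_form P M1 A1 B1 D1" and inj: "inj ((*v) M1)"
  shows "inj_on (\<lambda>(a1, a2). a1 + M1 *v a2) (A1 \<times> A2)"
proof (rule inj_onI; clarify)
  fix a1 a2 a1' a2'
  assume mem: "a1 \<in> A1" "a2 \<in> A2" "a1' \<in> A1" "a2' \<in> A2"
    and eq: "a1 + M1 *v a2 = a1' + M1 *v a2'"
  then have "a1 = a1' + M1 *v (a2' - a2)"
    by (simp add: algebra_simps)
  from factors_residues_unique_left[OF skew_formD(3)[OF S1] _ _ this] have "a1 = a1'"
    using mem by blast
  then show "a1 = a1' \<and> a2 = a2'"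
    using eq inj by (simp add: inj_eq)
qed

text \<open>Since \<open>P\<close> commutes with \<open>M\<^sub>1\<close>, one has
  \<open>(a\<^sub>1 + P b\<^sub>1) + M\<^sub>1 (a\<^sub>2 + P b\<^sub>2) = (a\<^sub>1 + M\<^sub>1 a\<^sub>2) + P (b\<^sub>1 + M\<^sub>1 b\<^sub>2)\<close>.
  So the factor belonging to \<open>a\<^sub>1 + M\<^sub>1 a\<^sub>2\<close> is \<open>B\<^sub>1 a\<^sub>1 + M\<^sub>1 (B\<^sub>2 a\<^sub>2)\<close>, and composing the two
  factorizations shows that it complements \<open>A\<^sub>1 + M\<^sub>1 A\<^sub>2\<close> modulo \<open>M\<^sub>1 ** M\<^sub>2\<close>.\<close>

lemma skew_form_compose:
  assumes S1: "skew_form P M1 A1 B1 D1" and S2: "skew_form P M2 A2 B2 D2"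
    and inj: "inj ((*v) M1)" and comm: "P ** M1 = M1 ** P"
  shows "\<exists>A B. skew_form P (M1 ** M2) A B (D1 + (*v) M1 ` D2)"
proof -
  define f where "f = (\<lambda>(a1, a2). a1 + M1 *v a2)"
  define g where "g = (\<lambda>(a1, a2). B1 a1 + (*v) M1 ` B2 a2)"
  define A where "A = f ` (A1 \<times> A2)"
  define B where "B = g \<circ> the_inv_into (A1 \<times> A2) f"
  have "inj_on f (A1 \<times> A2)"
    unfolding f_def by (rule inj_on_two_digits[OF S1 inj])
  then have B: "B (f p) = g p" if "p \<in> A1 \<times> A2" for p
    using that by (simp add: B_def the_inv_into_f_f)
  have A: "A = A1 + (*v) M1 ` A2"
    by (force simp: A_def f_def set_plus_def)
  have regroup: "(a1 + P *v b1) + M1 *v (a2 + P *v b2) = (a1 + M1 *v a2) + P *v (b1 + M1 *v b2)"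
    for a1 a2 b1 b2
    by (simp add: algebra_simps matrix_vector_mul_assoc comm)
  have "D1 + (*v) M1 ` D2 = (\<Union>p\<in>A1 \<times> A2. {f p} + (*v) P ` g p)"
  proof (intro set_eqI iffI)
    fix x assume "x \<in> D1 + (*v) M1 ` D2"
    then obtain a1 a2 b1 b2 where mem: "a1 \<in> A1" "b1 \<in> B1 a1" "a2 \<in> A2" "b2 \<in> B2 a2"
      and x: "x = (a1 + P *v b1) + M1 *v (a2 + P *v b2)"
      by (auto elim!: set_plus_elim simp: skew_form_mem[OF S1] skew_form_mem[OF S2])
    have "x \<in> {f (a1, a2)} + (*v) P ` g (a1, a2)"
      unfolding x regroup using mem by (auto simp: f_def g_def)
    then show "x \<in> (\<Union>p\<in>A1 \<times> A2. {f p} + (*v) P ` g p)"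
      using mem by blast
  next
    fix x assume "x \<in> (\<Union>p\<in>A1 \<times> A2. {f p} + (*v) P ` g p)"
    then obtain a1 a2 b1 b2 where mem: "a1 \<in> A1" "b1 \<in> B1 a1" "a2 \<in> A2" "b2 \<in> B2 a2"
      and x: "x = (a1 + M1 *v a2) + P *v (b1 + M1 *v b2)"
      by (auto elim!: set_plus_elim simp: f_def g_def)
    show "x \<in> D1 + (*v) M1 ` D2"
      unfolding x regroup[symmetric] using mem
      by (intro set_plus_intro imageI) (auto simp: skew_form_mem[OF S1] skew_form_mem[OF S2])
  qed
  moreover have "factors_residues (M1 ** M2) A (g p)" if "p \<in> A1 \<times> A2" for p
    using that factors_residues_compose[OF skew_formD(3)[OF S1] skew_formD(3)[OF S2] inj]
    by (auto simp: A g_def)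
  ultimately have "skew_form P (M1 ** M2) A B (D1 + (*v) M1 ` D2)"
    using skew_formD(1)[OF S1] skew_formD(1)[OF S2] B
    by (auto simp: skew_form_def A_def)
  then show ?thesis
    by blast
qed

text \<open>The sum is direct: reduction modulo \<open>M\<^sub>1\<close>, division by \<open>M\<^sub>1\<close> and reduction modulo \<open>M\<^sub>2\<close> recover
  \<open>a\<^sub>1\<close> and \<open>a\<^sub>2\<close>, as \<open>P\<close> is a multiple of \<open>M\<^sub>1 ** M\<^sub>2\<close>. After that \<open>P\<close> cancels, and reduction
  modulo \<open>M\<^sub>1\<close> recovers \<open>b\<^sub>1\<close>, then \<open>b\<^sub>2\<close>.\<close>

lemma card_sumset_skew_form:
  assumes S1: "skew_form P M1 A1 B1 D1" and S2: "skew_form P M2 A2 B2 D2"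
    and inj: "inj ((*v) M1)" and injP: "inj ((*v) P)"
    and comm: "P ** M1 = M1 ** P" and P: "P = M1 ** M2 ** Q"
  shows "card (D1 + (*v) M1 ` D2) = card D1 * card D2"
proof -
  have "inj_on (\<lambda>(x, y). x + M1 *v y) (D1 \<times> D2)"
  proof (rule inj_onI; clarify)
    fix x y x' y'
    assume "x \<in> D1" "y \<in> D2" "x' \<in> D1" "y' \<in> D2" and eq: "x + M1 *v y = x' + M1 *v y'"
    then obtain a1 b1 a2 b2 a1' b1' a2' b2'
      where mem: "a1 \<in> A1" "b1 \<in> B1 a1" "a2 \<in> A2" "b2 \<in> B2 a2"
        "a1' \<in> A1" "b1' \<in> B1 a1'" "a2' \<in> A2" "b2' \<in> B2 a2'"
        and xy: "x = a1 + P *v b1" "y = a2 + P *v b2" "x' = a1' + P *v b1'" "y' = a2' + P *v b2'"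
      by (auto simp: skew_form_mem[OF S1] skew_form_mem[OF S2])
    have eq1: "(a1 + M1 *v a2) + P *v (b1 + M1 *v b2) = (a1' + M1 *v a2') + P *v (b1' + M1 *v b2')"
      using eq by (simp add: xy algebra_simps matrix_vector_mul_assoc comm)
    define d where "d = Q *v ((b1' + M1 *v b2') - (b1 + M1 *v b2))"
    have "a1 + M1 *v a2 = a1' + M1 *v a2' + P *v ((b1' + M1 *v b2') - (b1 + M1 *v b2))"
      using eq1 by (simp add: matrix_vector_mult_diff_distrib algebra_simps)
    then have eq2: "a1 + M1 *v a2 = a1' + M1 *v (a2' + M2 *v d)"
      by (simp add: d_def P matrix_vector_mul_assoc[symmetric] matrix_vector_right_distrib
          add.assoc)
    then have "a1 = a1' + M1 *v (a2' + M2 *v d - a2)"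
      by (simp add: algebra_simps)
    from factors_residues_unique_left[OF skew_formD(3)[OF S1] _ _ this] have a1: "a1 = a1'"
      using mem by blast
    have "a2 = a2' + M2 *v d"
      using eq2 inj by (simp add: a1 inj_eq)
    from factors_residues_unique_left[OF skew_formD(3)[OF S2] _ _ this] have a2: "a2 = a2'"
      using mem by blast
    have eq3: "b1 + M1 *v b2 = b1' + M1 *v b2'"
      using eq1 injP by (simp add: a1 a2 inj_eq)
    then have "b1 = b1' + M1 *v (b2' - b2)"
      by (simp add: algebra_simps)
    from factors_residues_unique_right[OF skew_formD(3)[OF S1] _ _ this] have b1: "b1 = b1'"
      using mem a1 by blast
    have "b2 = b2'"
      using eq3 inj by (simp add: b1 inj_eq)
    then show "x = x' \<and> y = y'"
      by (simp add: xy a1 a2 b1)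
  qed
  moreover have "D1 + (*v) M1 ` D2 = (\<lambda>(x, y). x + M1 *v y) ` (D1 \<times> D2)"
    by (force simp: set_plus_def)
  ultimately show ?thesis
    by (simp add: card_image card_cartesian_product)
qed

section \<open>Iterating the composition\<close>

text \<open>The bound \<open>k \<le> m\<close> makes \<open>R\<^sup>m\<close> a multiple of the modulus \<open>R\<^sup>k\<close> reached so far.\<close>

lemma skew_form_power_sum:
  assumes inj: "inj ((*v) R)" and S: "skew_form (matpow R m) R A B D" and "k \<le> m"
  shows "(\<exists>A' B'. skew_form (matpow R m) (matpow R k) A' B' (\<Sum>i<k. (*v) (matpow R i) ` D)) \<and>
         card (\<Sum>i<k. (*v) (matpow R i) ` D) = card D ^ k"
  using \<open>k \<le> m\<close>
proof (induction k)
  case 0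
  have "skew_form (matpow R m) (matpow R 0) {0} (\<lambda>_. {0}) {0}"
    by (simp add: skew_form_def factors_residues_def)
  then show ?case
    by (auto simp: set_zero)
next
  case (Suc k)
  then obtain A' B'
    where S': "skew_form (matpow R m) (matpow R k) A' B' (\<Sum>i<k. (*v) (matpow R i) ` D)"
      and card: "card (\<Sum>i<k. (*v) (matpow R i) ` D) = card D ^ k"
    by auto
  have inj': "inj ((*v) (matpow R j))" for j
    using inj by (rule inj_matpow)
  have comm: "matpow R m ** matpow R k = matpow R k ** matpow R m"
    by (metis matpow_add add.commute)
  have P: "matpow R m = matpow R k ** R ** matpow R (m - Suc k)"
    using \<open>Suc k \<le> m\<close> by (metis matpow_add matpow_Suc_right le_add_diff_inverse)
  show ?case
    using skew_form_compose[OF S' S inj' comm]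
      card_sumset_skew_form[OF S' S inj' inj' comm P]
    by (simp only: sum.lessThan_Suc matpow_Suc_right card power_Suc2 simp_thms)
qed

theorem lemma1p4:
  fixes R :: "int ^ 'n ^ 'n" and m :: nat and D :: "(int ^ 'n) set"
  assumes "expanding R"
    and "m \<ge> 1"
    and "finite D" and "int (card D) = \<bar>det R\<bar>"
    and "staged_skew_product_digit_set m R D"
  shows "skew_product_digit_set (matpow R m) (\<Sum>k<m. (*v) (matpow R k) ` D)"
proof -
  obtain A B where "skew_form (matpow R m) R A B D"
    using assms(5) by (auto simp: staged_skew_product_digit_set_iff)
  from skew_form_power_sum[OF expanding_imp_inj[OF assms(1)] this order_refl]
  have form: "\<exists>A' B'. skew_form (matpow R m) (matpow R m) A' B' (\<Sum>k<m. (*v) (matpow R k) ` D)"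
    and card: "card (\<Sum>k<m. (*v) (matpow R k) ` D) = card D ^ m"
    by auto
  have "finite (\<Sum>k<j. (*v) (matpow R k) ` D)" for j
    using assms(3) by (induction j) (auto simp: set_zero intro!: finite_set_plus)
  moreover have "int (card (\<Sum>k<m. (*v) (matpow R k) ` D)) = \<bar>det (matpow R m)\<bar>"
    using assms(4) by (simp add: card det_matpow power_abs)
  ultimately show ?thesis
    using form by (simp add: skew_product_digit_set_def staged_skew_product_digit_set_iff)
qed

end
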